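(* A stacked triangulation with $n$ vertices has exactly $2^{n-3}$ bipolar orientations (for a fixed source $s$ and sink $t$ on the outer face).
   Context: A stacked triangulation is a plane triangulation that can be obtained from a triangle by iteratively adding vertices of degree 3 into bounded faces (i.e. placing a new vertex in a bounded triangular face and joining it to the three vertices of that face). A bipolar orientation with source $s$ and sink $t$, where $s\neq t$ are two fixed vertices on the outer face, is an acyclic orientation of the edges in which $s$ is the only vertex without incoming edges and $t$ is the only vertex without outgoing edges. *)

theory Defs
  imports "HOL-Analysis.Analysis"
begin

text \<open>
  A plane graph is a pair of a finite set \<open>V\<close> of points of the plane and a finite set \<open>E\<close> of
  arcs (as point sets) between them. Since the relative interior of an edge contains no
  vertex, the set of ends of an edge \<open>e\<close> is \<open>e \<inter> V\<close>.
\<close>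

definition arc_between :: "complex set \<Rightarrow> complex \<Rightarrow> complex \<Rightarrow> bool" where
  "arc_between e u v \<longleftrightarrow>
     (\<exists>g. arc g \<and> path_image g = e \<and> pathstart g = u \<and> pathfinish g = v)"

text \<open>
  Loops are excluded because an \<^const>\<open>arc\<close> is injective, and multiple edges because
  distinct edges have distinct sets of ends.
\<close>

definition plane_graph :: "complex set \<Rightarrow> complex set set \<Rightarrow> bool" where
  "plane_graph V E \<longleftrightarrow>
     finite V \<and> finite E \<and>
     (\<forall>e\<in>E. \<exists>u\<in>V. \<exists>v\<in>V. arc_between e u v \<and> e \<inter> V = {u, v}) \<and>
     (\<forall>e\<in>E. \<forall>e'\<in>E. e \<noteq> e' \<longrightarrow> e \<inter> V \<noteq> e' \<inter> V \<and> e \<inter> e' \<subseteq> V)"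

definition adjacent :: "complex set \<Rightarrow> complex set set \<Rightarrow> complex \<Rightarrow> complex \<Rightarrow> bool" where
  "adjacent V E u v \<longleftrightarrow> u \<noteq> v \<and> (\<exists>e\<in>E. e \<inter> V = {u, v})"

definition faces :: "complex set \<Rightarrow> complex set set \<Rightarrow> complex set set" where
  "faces V E = components (- (V \<union> \<Union>E))"

definition triangular_face ::
  "complex set \<Rightarrow> complex set set \<Rightarrow> complex set \<Rightarrow> complex \<Rightarrow> complex \<Rightarrow> complex \<Rightarrow> bool" where
  "triangular_face V E F a b c \<longleftrightarrow>
     F \<in> faces V E \<and> a \<noteq> b \<and> b \<noteq> c \<and> c \<noteq> a \<and>
     (\<exists>x\<in>E. \<exists>y\<in>E. \<exists>z\<in>E.
        x \<inter> V = {a, b} \<and> y \<inter> V = {b, c} \<and> z \<inter> V = {c, a} \<and> frontier F = x \<union> y \<union> z)"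

definition plane_triangulation :: "complex set \<Rightarrow> complex set set \<Rightarrow> bool" where
  "plane_triangulation V E \<longleftrightarrow>
     plane_graph V E \<and> (\<forall>F\<in>faces V E. \<exists>a b c. triangular_face V E F a b c)"

text \<open>
  In the base case, three edges with distinct sets of ends on three vertices form a triangle.
  In the step, the three new arcs run inside the face \<open>F\<close> except for their ends on its boundary
  and meet one another only in the new vertex \<open>v\<close>, so the result is again a plane graph.
\<close>

inductive obtainable_by_stacking :: "complex set \<Rightarrow> complex set set \<Rightarrow> bool" where
  triangle:
    "plane_graph V E \<Longrightarrow> card V = 3 \<Longrightarrow> card E = 3 \<Longrightarrow> obtainable_by_stacking V E"
| stack:
    "obtainable_by_stacking V E \<Longrightarrow> triangular_face V E F a b c \<Longrightarrow> bounded F \<Longrightarrow> v \<in> F \<Longrightarrow>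
     arc_between x v a \<Longrightarrow> arc_between y v b \<Longrightarrow> arc_between z v c \<Longrightarrow>
     x - {a} \<subseteq> F \<Longrightarrow> y - {b} \<subseteq> F \<Longrightarrow> z - {c} \<subseteq> F \<Longrightarrow>
     x \<inter> y = {v} \<Longrightarrow> y \<inter> z = {v} \<Longrightarrow> z \<inter> x = {v} \<Longrightarrow>
     obtainable_by_stacking (insert v V) (E \<union> {x, y, z})"

definition stacked_triangulation :: "complex set \<Rightarrow> complex set set \<Rightarrow> bool" where
  "stacked_triangulation V E \<longleftrightarrow> plane_triangulation V E \<and> obtainable_by_stacking V E"

text \<open>The outer face is the unbounded one; a vertex lies on it if it belongs to its boundary.\<close>

definition on_outer_face :: "complex set \<Rightarrow> complex set set \<Rightarrow> complex \<Rightarrow> bool" where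
  "on_outer_face V E v \<longleftrightarrow> v \<in> V \<and> (\<exists>F\<in>faces V E. \<not> bounded F \<and> v \<in> frontier F)"

text \<open>
  An orientation is the set \<open>R\<close> of ordered pairs \<open>(u, v)\<close> such that the edge between
  \<open>u\<close> and \<open>v\<close> is directed from \<open>u\<close> to \<open>v\<close>.
\<close>

definition orientation ::
  "complex set \<Rightarrow> complex set set \<Rightarrow> (complex \<times> complex) set \<Rightarrow> bool" where
  "orientation V E R \<longleftrightarrow>
     (\<forall>(u, v)\<in>R. adjacent V E u v) \<and>
     (\<forall>u v. adjacent V E u v \<longrightarrow> ((u, v) \<in> R \<longleftrightarrow> (v, u) \<notin> R))"

definition bipolar_orientation ::
  "complex set \<Rightarrow> complex set set \<Rightarrow> complex \<Rightarrow> complex \<Rightarrow> (complex \<times> complex) set \<Rightarrow> bool" where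
  "bipolar_orientation V E s t R \<longleftrightarrow>
     orientation V E R \<and> acyclic R \<and>
     (\<forall>v\<in>V. (\<nexists>u. (u, v) \<in> R) \<longleftrightarrow> v = s) \<and>
     (\<forall>v\<in>V. (\<nexists>u. (v, u) \<in> R) \<longleftrightarrow> v = t)"

end

theory Submission
  imports Defs
begin

text \<open>
  Stacking a vertex \<open>v\<close> into a triangle doubles the number of bipolar orientations, and a
  triangle has exactly one for each choice of \<open>s\<close> and \<open>t\<close>; this gives \<open>2 ^ (n - 3)\<close>.

  For the doubling, let \<open>R\<close> be a bipolar orientation before the step. It orders the triangle
  linearly, say \<open>p \<rightarrow> q \<rightarrow> r\<close>. An orientation of the three new edges is determined by the set
  \<open>I\<close> of triangle vertices pointing to \<open>v\<close>. As \<open>v\<close> must be neither source nor sink, \<open>I\<close> is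
  nonempty and proper; acyclicity forces \<open>I\<close> to be an initial segment of \<open>p, q, r\<close>. So \<open>I\<close> is
  \<open>{p}\<close> or \<open>{p, q}\<close> (\<open>card_cuts\<close>), and both work (\<open>bipolar_extend\<close>). Conversely, deleting \<open>v\<close>
  from a bipolar orientation creates no new source: if \<open>v \<rightarrow> w\<close> and \<open>u \<rightarrow> v\<close>, then the triangle
  edge between \<open>u\<close> and \<open>w\<close> must be directed \<open>u \<rightarrow> w\<close>, so \<open>w\<close> keeps an incoming edge; sinks are
  symmetric (\<open>bipolar_restrict\<close>).

  Geometry enters in two places. The interior of a face contains neither vertices nor edges, so
  \<open>v\<close> becomes adjacent to the three corners only and all other adjacencies persist
  (\<open>adjacency_stack\<close>). And a vertex placed in a bounded face is never on the outer face
  (\<open>on_outer_face_stack\<close>), so \<open>v\<close> is neither \<open>s\<close> nor \<open>t\<close>, which are vertices of the initial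
  triangle.
\<close>

section \<open>Bipolar orientations of a symmetric relation\<close>

text \<open>
  The graph is given by its symmetric adjacency relation \<open>A\<close>. That no edge is directed both ways
  is part of acyclicity.
\<close>

definition bipolar :: "'a set \<Rightarrow> 'a rel \<Rightarrow> 'a \<Rightarrow> 'a \<Rightarrow> 'a rel \<Rightarrow> bool" where
  "bipolar V A s t R \<longleftrightarrow>
     R \<union> R\<inverse> = A \<and> acyclic R \<and> V - Range R = {s} \<and> V - Domain R = {t}"

lemma acyclic_no_loop: "acyclic R \<Longrightarrow> (x, x) \<notin> R"
  unfolding acyclic_def by blast

lemma acyclic_no_2cycle: "acyclic R \<Longrightarrow> (x, y) \<in> R \<Longrightarrow> (y, x) \<notin> R"
  unfolding acyclic_def by (meson r_into_trancl' trancl_into_trancl)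

lemma acyclic_no_3cycle: "acyclic R \<Longrightarrow> (x, y) \<in> R \<Longrightarrow> (y, z) \<in> R \<Longrightarrow> (z, x) \<notin> R"
  unfolding acyclic_def by (meson r_into_trancl' trancl_into_trancl)

text \<open>
  A cycle cannot ascend in level, so it stays in one level, where all edges come from the acyclic
  relation \<open>R\<close>.
\<close>

lemma acyclic_if_levels:
  fixes f :: "'a \<Rightarrow> nat"
  assumes "acyclic R"
    and lev: "\<And>x y. (x, y) \<in> Q \<Longrightarrow> f x < f y \<or> (f x = f y \<and> (x, y) \<in> R)"
  shows "acyclic Q"
proof -
  have "f x < f y \<or> (f x = f y \<and> (x, y) \<in> R\<^sup>+)" if "(x, y) \<in> Q\<^sup>+" for x y
    using that
  proof (induction rule: trancl_induct)
    case (base y)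
    then show ?case using lev by blast
  next
    case (step y z)
    then show ?case using lev[OF step.hyps(2)] by (auto intro: trancl_into_trancl)
  qed
  then show ?thesis
    using \<open>acyclic R\<close> unfolding acyclic_def by blast
qed

section \<open>Stacking a vertex into a triangle\<close>

definition stack_adj :: "'a \<Rightarrow> 'a set \<Rightarrow> 'a rel \<Rightarrow> 'a rel" where
  "stack_adj v T A = A \<union> T \<times> {v} \<union> {v} \<times> T"

text \<open>The set \<open>I\<close> consists of the neighbours whose edge is directed towards \<open>v\<close>.\<close>

definition extend :: "'a \<Rightarrow> 'a set \<Rightarrow> 'a rel \<Rightarrow> 'a set \<Rightarrow> 'a rel" where
  "extend v T R I = R \<union> I \<times> {v} \<union> {v} \<times> (T - I)"

definition cuts :: "'a set \<Rightarrow> 'a rel \<Rightarrow> 'a set set" where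
  "cuts T R = {I. I \<noteq> {} \<and> I \<subset> T \<and> (\<forall>x\<in>I. \<forall>y\<in>T. (y, x) \<in> R \<longrightarrow> y \<in> I)}"

lemma acyclic_triangle_linear:
  assumes "acyclic R" and "(a, b) \<in> R \<or> (b, a) \<in> R" and "(b, c) \<in> R \<or> (c, b) \<in> R"
    and "(c, a) \<in> R \<or> (a, c) \<in> R"
  obtains p q r where "{a, b, c} = {p, q, r}" "(p, q) \<in> R" "(q, r) \<in> R" "(p, r) \<in> R"
proof -
  have "\<exists>p q r. {a, b, c} = {p, q, r} \<and> (p, q) \<in> R \<and> (q, r) \<in> R \<and> (p, r) \<in> R"
    using assms acyclic_no_3cycle[OF assms(1)] by (smt (verit) insert_commute)
  then show ?thesis using that by blast
qed

text \<open>The cuts of the linear order \<open>p \<rightarrow> q \<rightarrow> r\<close> are its two proper initial segments.\<close>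

lemma card_cuts:
  assumes "acyclic R" and "(a, b) \<in> R \<or> (b, a) \<in> R" and "(b, c) \<in> R \<or> (c, b) \<in> R"
    and "(c, a) \<in> R \<or> (a, c) \<in> R"
  shows "card (cuts {a, b, c} R) = 2"
proof -
  obtain p q r where T: "{a, b, c} = {p, q, r}" and R: "(p, q) \<in> R" "(q, r) \<in> R" "(p, r) \<in> R"
    using acyclic_triangle_linear[OF assms] by blast
  note ac = acyclic_no_loop[OF assms(1)] acyclic_no_2cycle[OF assms(1)]
  have ne: "p \<noteq> q" "q \<noteq> r" "p \<noteq> r" using R ac by blast+
  have "cuts {p, q, r} R = {{p}, {p, q}}"
  proof (rule set_eqI)
    fix I
    have "I \<in> cuts {p, q, r} R \<longleftrightarrow>
        I \<subseteq> {p, q, r} \<and> p \<in> I \<and> r \<notin> I"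
      unfolding cuts_def using R ac by blast
    also have "\<dots> \<longleftrightarrow> I \<in> {{p}, {p, q}}"
      using ne by blast
    finally show "I \<in> cuts {p, q, r} R \<longleftrightarrow> I \<in> {{p}, {p, q}}" .
  qed
  moreover have "{p} \<noteq> {p, q}" using ne by blast
  ultimately show ?thesis using T by simp
qed

text \<open>
  The vertices from which \<open>I\<close> can be reached form a set that contains \<open>I\<close> and avoids \<open>T - I\<close>.
  Placing \<open>v\<close> between this set and the remaining vertices shows that no cycle arises.
\<close>

lemma acyclic_extend:
  assumes R: "acyclic R" and v: "v \<notin> Field R" and vT: "v \<notin> T"
    and total: "total_on T R"
    and I: "I \<in> cuts T R"
  shows "acyclic (extend v T R I)"
proof -
  define D where "D = {u. \<exists>i\<in>I. (u, i) \<in> R\<^sup>*}"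
  define f :: "'a \<Rightarrow> nat" where "f u = (if u = v then 1 else if u \<in> D then 0 else 2)" for u
  have ID: "I \<subseteq> D" and IT: "I \<subseteq> T" unfolding D_def using I by (auto simp: cuts_def)
  have out: "x \<notin> D" if x: "x \<in> T - I" for x
  proof
    assume "x \<in> D"
    then obtain i where i: "i \<in> I" "(x, i) \<in> R\<^sup>*" unfolding D_def by blast
    have "(x, i) \<notin> R" using I x i(1) by (auto simp: cuts_def)
    then have "(i, x) \<in> R" using total x i(1) IT unfolding total_on_def by (metis DiffD1 DiffD2 subsetD)
    then have "(i, i) \<in> R\<^sup>+" using i(2) by (meson rtrancl_into_trancl2)
    then show False using R unfolding acyclic_def by blast
  qed
  have down: "x \<in> D" if "(x, y) \<in> R" "y \<in> D" for x y
    using that unfolding D_def by (blast intro: converse_rtrancl_into_rtrancl)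
  show ?thesis
  proof (rule acyclic_if_levels[OF R, where f = f])
    fix x y assume "(x, y) \<in> extend v T R I"
    then consider "(x, y) \<in> R" | "x \<in> I" "y = v" | "x = v" "y \<in> T - I"
      unfolding extend_def by blast
    then show "f x < f y \<or> (f x = f y \<and> (x, y) \<in> R)"
    proof cases
      case 1
      then have "x \<noteq> v" "y \<noteq> v" using v by (auto simp: Field_def)
      then show ?thesis using 1 down[OF 1] by (auto simp: f_def)
    next
      case 2
      then show ?thesis using ID IT vT by (auto simp: f_def)
    next
      case 3
      then show ?thesis using out vT by (auto simp: f_def)
    qed
  qed
qed

text \<open>
  As \<open>I\<close> is nonempty and proper, \<open>v\<close> is neither a source nor a sink. It gives \<open>s\<close> no incoming
  edge, because a cut contains \<open>s\<close> whenever the triangle does; dually, it gives \<open>t\<close> no outgoing one.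
\<close>

lemma bipolar_extend:
  assumes R: "bipolar V A s t R" and AV: "A \<subseteq> V \<times> V" and v: "v \<notin> V" and TV: "T \<subseteq> V"
    and total: "total_on T A"
    and I: "I \<in> cuts T R"
  shows "bipolar (insert v V) (stack_adj v T A) s t (extend v T R I)"
proof -
  have RA: "R \<union> R\<inverse> = A" and ac: "acyclic R" and src: "V - Range R = {s}"
    and snk: "V - Domain R = {t}" using R by (auto simp: bipolar_def)
  have IT: "I \<subset> T" "I \<noteq> {}" and down: "\<And>x y. x \<in> I \<Longrightarrow> y \<in> T \<Longrightarrow> (y, x) \<in> R \<Longrightarrow> y \<in> I"
    using I by (auto simp: cuts_def)
  have RV: "R \<subseteq> V \<times> V" using RA AV by blast
  have totalR: "total_on T R"
    using total RA unfolding total_on_def by blast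
  obtain i j where i: "i \<in> I" and j: "j \<in> T - I" using IT by blast
  \<comment> \<open>Inside the triangle, \<open>s\<close> could only point outwards and \<open>t\<close> only inwards.\<close>
  have s: "s \<notin> T - I"
  proof
    assume sT: "s \<in> T - I"
    have "(i, s) \<notin> R" using src by blast
    then have "(s, i) \<in> R" using totalR sT i IT(1) unfolding total_on_def by (metis DiffD1 DiffD2 psubsetD)
    then show False using down i sT by blast
  qed
  have t: "t \<notin> I"
  proof
    assume tI: "t \<in> I"
    have "(t, j) \<notin> R" using snk by blast
    then have "(j, t) \<in> R" using totalR tI j IT(1) unfolding total_on_def by (metis DiffD1 DiffD2 psubsetD)
    then show False using down tI j by blast
  qed
  have "extend v T R I \<union> (extend v T R I)\<inverse> = stack_adj v T A"
    using RA IT(1) unfolding extend_def stack_adj_def by blast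
  moreover have "acyclic (extend v T R I)"
    using acyclic_extend[OF ac _ _ totalR I] RV v TV by (auto simp: Field_def)
  moreover have "Range (extend v T R I) = Range R \<union> {v} \<union> (T - I)"
    using i unfolding extend_def by blast
  then have "insert v V - Range (extend v T R I) = {s}"
    using src s v by blast
  moreover have "Domain (extend v T R I) = Domain R \<union> {v} \<union> I"
    using j unfolding extend_def by blast
  then have "insert v V - Domain (extend v T R I) = {t}"
    using snk t v by blast
  ultimately show ?thesis unfolding bipolar_def by blast
qed

text \<open>
  Every path through \<open>v\<close> has a shortcut along an edge of the triangle. So a vertex that has an edge
  from (to) \<open>v\<close> also has one from (to) a vertex of the triangle, and removing \<open>v\<close> creates neither
  sources nor sinks. The same shortcuts say that no edge enters \<open>I\<close> from the rest of \<open>T\<close>.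
\<close>

lemma bipolar_restrict:
  assumes Q: "bipolar (insert v V) (stack_adj v T A) s t Q"
    and AV: "A \<subseteq> V \<times> V" and v: "v \<notin> V" and TV: "T \<subseteq> V" and s: "s \<noteq> v" and t: "t \<noteq> v"
    and total: "total_on T A"
  defines "R \<equiv> Q \<inter> V \<times> V" and "I \<equiv> {u. (u, v) \<in> Q}"
  shows "bipolar V A s t R" and "I \<in> cuts T R" and "Q = extend v T R I"
proof -
  have QA: "Q \<union> Q\<inverse> = stack_adj v T A" and ac: "acyclic Q"
    and src: "insert v V - Range Q = {s}" and snk: "insert v V - Domain Q = {t}"
    using Q by (auto simp: bipolar_def)
  have RA: "R \<union> R\<inverse> = A"
  proof -
    have "R \<union> R\<inverse> = stack_adj v T A \<inter> V \<times> V" using QA unfolding R_def by blast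
    also have "\<dots> = A" using AV v unfolding stack_adj_def by blast
    finally show ?thesis .
  qed
  have IT: "I \<subseteq> T"
    using QA AV v unfolding I_def stack_adj_def by blast
  have out: "(v, u) \<in> Q \<longleftrightarrow> u \<in> T - I" for u
  proof
    assume vu: "(v, u) \<in> Q"
    then have "u \<in> T" using QA AV v TV unfolding stack_adj_def by blast
    then show "u \<in> T - I" using acyclic_no_2cycle[OF ac vu] unfolding I_def by blast
  next
    assume "u \<in> T - I"
    then show "(v, u) \<in> Q" using QA unfolding I_def stack_adj_def by blast
  qed
  \<comment> \<open>A path \<open>x \<rightarrow> v \<rightarrow> y\<close> is shortcut by the edge between \<open>x\<close> and \<open>y\<close>, on pain of a 3-cycle.\<close>
  have shortcut: "(x, y) \<in> R" if "x \<in> I" "y \<in> T - I" for x y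
  proof -
    have "x \<in> T" "y \<in> T" "x \<noteq> y" using that IT by blast+
    then have "(x, y) \<in> A \<or> (y, x) \<in> A" using total unfolding total_on_def by blast
    then have "(x, y) \<in> R \<or> (y, x) \<in> R" using RA by blast
    moreover have "(y, x) \<notin> Q"
      using acyclic_no_3cycle[OF ac, of x v y] that out I_def by blast
    ultimately show ?thesis unfolding R_def by blast
  qed
  have "v \<in> Range Q" using src s by (metis DiffI insertI1 singletonD)
  have "v \<in> Domain Q" using snk t by (metis DiffI insertI1 singletonD)
  obtain i j where i: "i \<in> I" and j: "j \<in> T - I"
    using \<open>v \<in> Range Q\<close> \<open>v \<in> Domain Q\<close> out unfolding I_def by blast
  have acR: "acyclic R" using ac acyclic_subset unfolding R_def by blast
  have Qsplit: "Q \<subseteq> R \<union> I \<times> {v} \<union> {v} \<times> (T - I)"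
  proof
    fix e assume e: "e \<in> Q"
    obtain x y where xy: "e = (x, y)" by fastforce
    have "x = v \<or> y = v \<or> e \<in> V \<times> V"
      using e xy QA AV unfolding stack_adj_def by blast
    then show "e \<in> R \<union> I \<times> {v} \<union> {v} \<times> (T - I)"
      using e xy out unfolding R_def I_def by blast
  qed
  then show "Q = extend v T R I"
    using out unfolding extend_def R_def I_def by blast
  have "w \<in> Range R" if "(u, w) \<in> Q" "w \<in> V" for u w
    using that Qsplit shortcut[OF i, of w] v by blast
  then have "V - Range R = V - Range Q" unfolding R_def by blast
  moreover have "w \<in> Domain R" if "(w, u) \<in> Q" "w \<in> V" for u w
    using that Qsplit shortcut[OF _ j, of w] v by blast
  then have "V - Domain R = V - Domain Q" unfolding R_def by blast
  moreover have "V - Range Q = {s}" "V - Domain Q = {t}"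
    using src snk \<open>v \<in> Range Q\<close> \<open>v \<in> Domain Q\<close> by auto
  ultimately show "bipolar V A s t R" using RA acR unfolding bipolar_def by simp
  show "I \<in> cuts T R"
    using IT i j shortcut acyclic_no_2cycle[OF acR] unfolding cuts_def by blast
qed

text \<open>
  Deleting \<open>v\<close> and recording its in-neighbours inverts \<open>extend\<close>. So the new bipolar orientations
  correspond to the pairs of an old one and one of its two cuts.
\<close>

lemma card_bipolar_stack:
  assumes fin: "finite V" and AV: "A \<subseteq> V \<times> V" and v: "v \<notin> V" and TV: "{a, b, c} \<subseteq> V"
    and tri: "(a, b) \<in> A" "(b, c) \<in> A" "(c, a) \<in> A"
    and s: "s \<noteq> v" and t: "t \<noteq> v"
  shows "card {Q. bipolar (insert v V) (stack_adj v {a, b, c} A) s t Q}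
    = 2 * card {R. bipolar V A s t R}"
proof -
  let ?T = "{a, b, c}"
  let ?old = "{R. bipolar V A s t R}"
  have total: "total_on ?T A"
    using tri unfolding total_on_def by blast
  have old: "R \<subseteq> V \<times> V" if "R \<in> ?old" for R
    using that AV unfolding bipolar_def by blast
  have "finite ?old"
    using old by (intro finite_subset[of ?old "Pow (V \<times> V)"]) (use fin in auto)
  have two: "card (cuts ?T R) = 2" if "R \<in> ?old" for R
    using that tri unfolding bipolar_def by (intro card_cuts) blast+
  have "{Q. bipolar (insert v V) (stack_adj v ?T A) s t Q}
    = (\<lambda>(R, I). extend v ?T R I) ` Sigma ?old (cuts ?T)" (is "?new = ?img")
  proof (intro equalityI subsetI)
    fix Q assume "Q \<in> ?new"
    then show "Q \<in> ?img"
      using bipolar_restrict[OF _ AV v TV s t total, of Q] by blast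
  next
    fix Q assume "Q \<in> ?img"
    then obtain R I where "bipolar V A s t R" "I \<in> cuts ?T R" and Q: "Q = extend v ?T R I"
      by auto
    then show "Q \<in> ?new"
      unfolding Q using bipolar_extend[OF _ AV v TV total] by simp
  qed
  moreover have "inj_on (\<lambda>(R, I). extend v ?T R I) (Sigma ?old (cuts ?T))"
  proof (rule inj_on_inverseI[where g = "\<lambda>Q. (Q \<inter> V \<times> V, {u. (u, v) \<in> Q})"])
    fix P assume "P \<in> Sigma ?old (cuts ?T)"
    then obtain R I where P: "P = (R, I)" and R: "R \<in> ?old" and "I \<in> cuts ?T R" by blast
    then have "I \<subseteq> ?T" by (auto simp: cuts_def)
    then show "((case P of (R, I) \<Rightarrow> extend v ?T R I) \<inter> V \<times> V,
        {u. (u, v) \<in> (case P of (R, I) \<Rightarrow> extend v ?T R I)}) = P"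
      using old[OF R] v TV unfolding P extend_def by auto
  qed
  ultimately have "card ?new = card (Sigma ?old (cuts ?T))"
    by (simp add: card_image)
  also have "\<dots> = (\<Sum>R\<in>?old. card (cuts ?T R))"
    using \<open>finite ?old\<close> two by (intro card_SigmaI) (auto intro: card_ge_0_finite)
  also have "\<dots> = 2 * card ?old"
    using two by simp
  finally show ?thesis .
qed

text \<open>
  All edges at \<open>s\<close> point away from it and all edges at \<open>t\<close> point to it; in a triangle this
  determines every edge.
\<close>

lemma card_bipolar_triangle:
  assumes V: "card V = 3" and s: "s \<in> V" and t: "t \<in> V" and "s \<noteq> t"
  shows "card {R. bipolar V {(x, y) \<in> V \<times> V. x \<noteq> y} s t R} = 1"
proof -
  have "card (V - {s, t}) = 1" using assms by (simp add: card_Diff_subset)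
  then obtain m where "V - {s, t} = {m}" by (auto simp: card_1_singleton_iff)
  then have Vm: "V = {s, m, t}" and m: "m \<noteq> s" "m \<noteq> t" using s t by blast+
  let ?A = "{(x, y) \<in> V \<times> V. x \<noteq> y}"
  let ?R = "{(s, m), (m, t), (s, t)}"
  have A: "?A = ?R \<union> ?R\<inverse>" using Vm m \<open>s \<noteq> t\<close> by auto
  have acyc: "acyclic ?R"
    by (rule acyclic_if_levels[where R = "{}" and f = "\<lambda>x. if x = s then 0 else if x = m then 1 else 2"])
      (use m \<open>s \<noteq> t\<close> in \<open>auto simp: acyclic_def\<close>)
  have "V - Range ?R = {s}" "V - Domain ?R = {t}" using Vm m \<open>s \<noteq> t\<close> by auto
  then have "bipolar V ?A s t ?R" unfolding bipolar_def using A acyc by simp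
  moreover have "R = ?R" if "bipolar V ?A s t R" for R
  proof -
    have RA: "R \<union> R\<inverse> = ?R \<union> ?R\<inverse>"
      using that unfolding bipolar_def A by simp
    have RV: "V - Range R = {s}" "V - Domain R = {t}"
      using that by (simp_all add: bipolar_def)
    have "s \<in> V - Range R" "t \<in> V - Domain R" unfolding RV by simp_all
    then have src: "(x, s) \<notin> R" and snk: "(t, x) \<notin> R" for x
      by blast+
    have "R \<subseteq> ?R"
    proof (rule subrelI)
      fix x y assume xy: "(x, y) \<in> R"
      then have "(x, y) \<in> ?R \<union> ?R\<inverse>" unfolding RA[symmetric] by simp
      moreover have "x \<noteq> t" "y \<noteq> s" using xy src[of x] snk[of y] by auto
      ultimately show "(x, y) \<in> ?R" by auto
    qed
    moreover have "(s, m) \<in> R \<union> R\<inverse>" "(m, t) \<in> R \<union> R\<inverse>" "(s, t) \<in> R \<union> R\<inverse>"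
      unfolding RA by simp_all
    then have "?R \<subseteq> R" using src snk by simp
    ultimately show ?thesis by blast
  qed
  ultimately have "{R. bipolar V ?A s t R} = {?R}" by blast
  then show ?thesis by simp
qed

section \<open>Adjacency in stacked plane graphs\<close>

abbreviation adjacency :: "complex set \<Rightarrow> complex set set \<Rightarrow> complex rel" where
  "adjacency V E \<equiv> {(u, v). adjacent V E u v}"

lemma sym_adjacency: "sym (adjacency V E)"
  unfolding adjacent_def by (auto simp: sym_def insert_commute)

lemma adjacency_subset: "adjacency V E \<subseteq> V \<times> V"
  unfolding adjacent_def by blast

text \<open>
  Membership in \<open>V\<close> matters: for \<open>s \<notin> V\<close>, the left-hand side would demand that no vertex is a
  source, and the right-hand side would be false.
\<close>

lemma bipolar_orientation_iff_bipolar: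
  assumes "s \<in> V" "t \<in> V"
  shows "bipolar_orientation V E s t R \<longleftrightarrow> bipolar V (adjacency V E) s t R"
proof -
  have o: "orientation V E R \<longleftrightarrow> R \<union> R\<inverse> = adjacency V E" if "acyclic R"
  proof
    assume o: "orientation V E R"
    have "R \<subseteq> adjacency V E" using o unfolding orientation_def by blast
    then have "R \<union> R\<inverse> \<subseteq> adjacency V E" using sym_adjacency[of V E] by (auto dest: symD)
    moreover have "adjacency V E \<subseteq> R \<union> R\<inverse>" using o unfolding orientation_def by blast
    ultimately show "R \<union> R\<inverse> = adjacency V E" by blast
  next
    assume "R \<union> R\<inverse> = adjacency V E"
    then have adj: "adjacent V E u v \<longleftrightarrow> (u, v) \<in> R \<or> (v, u) \<in> R" for u v by blast
    show "orientation V E R"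
      unfolding orientation_def adj using acyclic_no_2cycle[OF that] by blast
  qed
  have p: "(\<forall>v\<in>V. (\<nexists>u. (u, v) \<in> R) \<longleftrightarrow> v = s) \<longleftrightarrow> V - Range R = {s}"
    using assms(1) unfolding set_eq_iff Diff_iff Range_iff singleton_iff by metis
  have q: "(\<forall>v\<in>V. (\<nexists>u. (v, u) \<in> R) \<longleftrightarrow> v = t) \<longleftrightarrow> V - Domain R = {t}"
    using assms(2) unfolding set_eq_iff Diff_iff Domain_iff singleton_iff by metis
  show ?thesis
    unfolding bipolar_orientation_def bipolar_def p q using o by (cases "acyclic R") simp_all
qed

lemma plane_graph_edge:
  "plane_graph V E \<Longrightarrow> e \<in> E \<Longrightarrow> \<exists>u\<in>V. \<exists>w\<in>V. arc_between e u w \<and> e \<inter> V = {u, w}"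
  by (simp add: plane_graph_def)

text \<open>The three edges have distinct two-element sets of ends, so they realise all three pairs.\<close>

lemma adjacency_triangle:
  assumes G: "plane_graph V E" and V: "card V = 3" and E: "card E = 3"
  shows "adjacency V E = {(x, y) \<in> V \<times> V. x \<noteq> y}"
proof -
  have fin: "finite V" using V by (simp add: card_ge_0_finite)
  let ?P = "{S. S \<subseteq> V \<and> card S = 2}"
  have "e \<inter> V \<in> ?P" if e: "e \<in> E" for e
  proof -
    obtain u w where uw: "u \<in> V" "w \<in> V" "arc_between e u w" "e \<inter> V = {u, w}"
      using plane_graph_edge[OF G e] by blast
    have "u \<noteq> w" using uw(3) arc_distinct_ends unfolding arc_between_def by metis
    then show ?thesis using uw by simp
  qed
  then have sub: "(\<lambda>e. e \<inter> V) ` E \<subseteq> ?P" by blast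
  have "inj_on (\<lambda>e. e \<inter> V) E"
    using G by (auto simp: plane_graph_def intro!: inj_onI)
  then have "card ((\<lambda>e. e \<inter> V) ` E) = card ?P"
    using n_subsets[OF fin, of 2] V E by (simp add: card_image numeral_eq_Suc)
  then have all: "(\<lambda>e. e \<inter> V) ` E = ?P"
    using sub fin by (intro card_subset_eq) auto
  have "adjacent V E x y" if "x \<in> V" "y \<in> V" "x \<noteq> y" for x y
  proof -
    have "{x, y} \<in> (\<lambda>e. e \<inter> V) ` E" unfolding all using that by auto
    then show ?thesis using that unfolding adjacent_def by auto
  qed
  moreover have "x \<in> V \<and> y \<in> V \<and> x \<noteq> y" if "adjacent V E x y" for x y
    using that unfolding adjacent_def by blast
  ultimately show ?thesis by blast
qed

lemma triangular_face_component:
  "triangular_face V E F a b c \<Longrightarrow> F \<in> components (- (V \<union> \<Union>E))"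
  by (simp only: triangular_face_def faces_def)

lemma triangular_face_disjoint:
  "triangular_face V E F a b c \<Longrightarrow> F \<inter> (V \<union> \<Union>E) = {}"
  using in_components_subset[OF triangular_face_component] by blast

lemma triangular_face_adjacency:
  assumes "triangular_face V E F a b c"
  shows "(a, b) \<in> adjacency V E" "(b, c) \<in> adjacency V E" "(c, a) \<in> adjacency V E"
  using assms by (auto simp: triangular_face_def adjacent_def)

text \<open>
  A face contains no vertex, so a new arc meets the vertices in its two ends only; and the old edges
  avoid \<open>F\<close>, so they do not acquire \<open>v\<close> as an end.
\<close>

lemma adjacency_stack:
  assumes F: "triangular_face V E F a b c" and v: "v \<in> F"
    and ends: "arc_between x v a" "arc_between y v b" "arc_between z v c"
    and inside: "x - {a} \<subseteq> F" "y - {b} \<subseteq> F" "z - {c} \<subseteq> F"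
  shows "adjacency (insert v V) (E \<union> {x, y, z}) = stack_adj v {a, b, c} (adjacency V E)"
proof -
  have dis: "F \<inter> V = {}" "F \<inter> \<Union>E = {}" using triangular_face_disjoint[OF F] by blast+
  have abc: "a \<in> V" "b \<in> V" "c \<in> V"
    using triangular_face_adjacency[OF F] adjacency_subset[of V E] by auto
  have new: "e \<inter> insert v V = {v, d}"
    if "arc_between e v d" "e - {d} \<subseteq> F" "d \<in> V" for e d
  proof -
    have "v \<in> e" "d \<in> e"
      using that(1) unfolding arc_between_def by (auto simp: pathstart_in_path_image pathfinish_in_path_image)
    then show ?thesis using that dis by blast
  qed
  have xyz: "x \<inter> insert v V = {v, a}" "y \<inter> insert v V = {v, b}" "z \<inter> insert v V = {v, c}"
    using new ends inside abc by blast+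
  have old: "e \<inter> insert v V = e \<inter> V" if "e \<in> E" for e
    using that dis v by blast
  have ne: "v \<noteq> a" "v \<noteq> b" "v \<noteq> c" using v abc dis by blast+
  have E: "(\<exists>e\<in>E. e \<inter> insert v V = {p, q}) \<longleftrightarrow> (\<exists>e\<in>E. e \<inter> V = {p, q})" for p q
    by (rule bex_cong[OF refl]) (simp only: old)
  have "adjacent (insert v V) (E \<union> {x, y, z}) p q \<longleftrightarrow>
      adjacent V E p q \<or> p \<noteq> q \<and> ({v, a} = {p, q} \<or> {v, b} = {p, q} \<or> {v, c} = {p, q})" for p q
    by (simp only: adjacent_def bex_Un E bex_simps xyz simp_thms conj_disj_distribL disj_assoc)
  then show ?thesis
    unfolding stack_adj_def using ne by (auto simp: doubleton_eq_iff)
qed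

section \<open>The outer face under stacking\<close>

text \<open>Finiteness and closedness of the edges serve to show that faces are open.\<close>

lemma obtainable_by_stacking_finite_closed:
  assumes "obtainable_by_stacking V E"
  shows "finite V \<and> finite E \<and> (\<forall>e\<in>E. closed e) \<and> 3 \<le> card V"
proof -
  have arc_closed: "closed e" if e: "arc_between e u w" for e u w
  proof -
    obtain g where "arc g" "path_image g = e" using e unfolding arc_between_def by blast
    then show ?thesis using closed_arc_image[of g] by simp
  qed
  show ?thesis
    using assms
  proof induction
    case (triangle V E)
    then show ?case
      using arc_closed plane_graph_edge[of V E] by (auto simp: plane_graph_def)
  next
    case (stack V E F a b c v x y z)
    then show ?case using arc_closed by (auto simp: card_insert_if)
  qed
qed

text \<open>
  The new points lie in the bounded face \<open>F\<close>, up to vertices already present, so every face other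
  than \<open>F\<close> stays a face and the unbounded faces do not change. As \<open>F\<close> is open, \<open>v\<close> is not in the
  closure of any of them.
\<close>

lemma on_outer_face_stack:
  assumes G: "obtainable_by_stacking V E"
    and F: "triangular_face V E F a b c" "bounded F" and v: "v \<in> F"
    and inside: "x - {a} \<subseteq> F" "y - {b} \<subseteq> F" "z - {c} \<subseteq> F"
    and w: "on_outer_face (insert v V) (E \<union> {x, y, z}) w"
  shows "on_outer_face V E w" and "w \<noteq> v"
proof -
  let ?G = "V \<union> \<Union>E" and ?H = "insert v V \<union> \<Union>(E \<union> {x, y, z})"
  have Ff: "F \<in> components (- ?G)" using triangular_face_component[OF F(1)] .
  have abc: "a \<in> V" "b \<in> V" "c \<in> V"
    using triangular_face_adjacency[OF F(1)] adjacency_subset[of V E] by auto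
  have GH: "?G \<subseteq> ?H" and HG: "?H \<subseteq> ?G \<union> F" using v inside abc by blast+
  obtain C where C: "C \<in> components (- ?H)" "\<not> bounded C" "w \<in> frontier C" and wV: "w \<in> insert v V"
    using w unfolding on_outer_face_def faces_def by blast
  have Cne: "C \<noteq> {}" and Ccon: "connected C" and CH: "C \<subseteq> - ?H"
    using C(1) in_components_nonempty in_components_connected in_components_subset by blast+
  obtain K where K: "K \<in> components (- ?G)" and CK: "C \<subseteq> K"
    using exists_component_superset[of C "- ?G"] Cne Ccon CH GH by blast
  have "K \<noteq> F" using CK C(2) F(2) bounded_subset by blast
  then have KF: "K \<inter> F = {}" using components_nonoverlap[OF K Ff] by blast
  then have "K \<subseteq> - ?H" using in_components_subset[OF K] HG by blast
  then have "K \<subseteq> C"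
    using components_maximal[OF C(1) in_components_connected[OF K]] CK Cne by blast
  then have "C = K" using CK by blast
  have "closed ?G"
    using obtainable_by_stacking_finite_closed[OF G] by (intro closed_Un closed_Union) (auto intro: finite_imp_closed)
  then have "open F" using open_components[OF _ Ff] by blast
  then have "F \<inter> closure K = {}" using KF open_Int_closure_eq_empty by blast
  then show "w \<noteq> v" using C(3) v \<open>C = K\<close> unfolding frontier_def by blast
  then show "on_outer_face V E w"
    using wV C \<open>C = K\<close> K unfolding on_outer_face_def faces_def by blast
qed

section \<open>The count\<close>

lemma card_bipolar_obtainable_by_stacking:
  assumes "obtainable_by_stacking V E" "on_outer_face V E s" "on_outer_face V E t" "s \<noteq> t"
  shows "card {R. bipolar V (adjacency V E) s t R} = 2 ^ (card V - 3)"
  using assms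
proof induction
  case (triangle V E)
  then have "s \<in> V" "t \<in> V" unfolding on_outer_face_def by blast+
  then show ?case
    using triangle card_bipolar_triangle[of V s t]
    unfolding adjacency_triangle[OF triangle.hyps] by simp
next
  case (stack V E F a b c v x y z)
  note outer = on_outer_face_stack[OF stack.hyps(1,2,3,4,8,9,10)]
  note adj = triangular_face_adjacency[OF stack.hyps(2)]
  have fin: "finite V" and three: "3 \<le> card V"
    using obtainable_by_stacking_finite_closed[OF stack.hyps(1)] by blast+
  have v: "v \<notin> V" using triangular_face_disjoint[OF stack.hyps(2)] stack.hyps(4) by blast
  have abc: "{a, b, c} \<subseteq> V" using adj adjacency_subset[of V E] by blast
  have "card {R. bipolar (insert v V) (adjacency (insert v V) (E \<union> {x, y, z})) s t R}
      = 2 * card {R. bipolar V (adjacency V E) s t R}"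
    unfolding adjacency_stack[OF stack.hyps(2,4-10)]
    by (rule card_bipolar_stack[OF fin adjacency_subset v abc adj])
      (use outer(2) stack.prems in blast)+
  also have "\<dots> = 2 ^ Suc (card V - 3)"
    using stack.IH outer(1) stack.prems by simp
  also have "Suc (card V - 3) = card (insert v V) - 3"
    using fin v three by simp
  finally show ?case .
qed

theorem proposition8:
  fixes V :: "complex set" and E :: "complex set set" and s t :: complex and n :: nat
  assumes "stacked_triangulation V E" and "card V = n"
    and "on_outer_face V E s" and "on_outer_face V E t" and "s \<noteq> t"
  shows "card {R. bipolar_orientation V E s t R} = 2 ^ (n - 3)"
proof -
  have "s \<in> V" "t \<in> V" using assms(3,4) by (simp_all add: on_outer_face_def)
  moreover have "obtainable_by_stacking V E"
    using assms(1) by (simp add: stacked_triangulation_def)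
  ultimately show ?thesis
    using card_bipolar_obtainable_by_stacking assms(2-5)
    by (simp add: bipolar_orientation_iff_bipolar)
qed

end
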